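(* Let $n\ge 1$, let $\boldsymbol{p} > \boldsymbol{0}$ and $\boldsymbol{q} > \boldsymbol{0}$ be $n$-dimensional stochastic vectors, and define $$\mathcal{G}=\{i: p_i>q_i\},\qquad \mathcal{E}=\{i:p_i=q_i\},\qquad \mathcal{L}=\{i:p_i<q_i\}.$$ Then the matrix $\overline{U}\in\mathbb{R}^{n\times n}$ corresponding to $(\boldsymbol{p},\boldsymbol{q})$ is the unique optimal solution of the linear program $$\max\{\operatorname{tr}(U): U\in\mathcal{U}\}$$ if and only if $|\mathcal{G}|\le 1$ or $|\mathcal{L}|\le 1$.
   Context: Vectors are column vectors; inequalities between vectors or matrices are entrywise; $\boldsymbol{1}$ is the all-ones vector and $\boldsymbol{0}$ the zero vector. A vector $\boldsymbol{a}\in\mathbb{R}^n$ is stochastic if $\boldsymbol{a}^\top\boldsymbol{1}=1$ and $\boldsymbol{a}\ge\boldsymbol{0}$. Write $[c]^+=\max\{c,0\}$. For $\boldsymbol{p},\boldsymbol{q}$ define $$\mathcal{U}=\{U\in\mathbb{R}^{n\times n}: U^\top\boldsymbol{q}=\boldsymbol{p},\ U\boldsymbol{1}=\boldsymbol{1},\ U\ge 0\}.$$ The matrix $\overline{U}\in\mathbb{R}^{n\times n}$ corresponding to $(\boldsymbol{p},\boldsymbol{q})$ has entries $$\overline{u}_{ij}=\begin{cases}1-[1-p_i/q_i]^+, & i=j,\\ 0, & i\ne j \text{ and } \boldsymbol{p}=\boldsymbol{q},\\ \dfrac{[1-p_i/q_i]^+\,[p_j-q_j]^+}{\sum_{k=1}^n[p_k-q_k]^+},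 & i\neq j\text{ and }\boldsymbol{p}\ne\boldsymbol{q}.\end{cases}$$ *)

theory Defs
  imports "HOL-Analysis.Analysis"
begin

text \<open>
  The order on \<^typ>\<open>real ^ 'n\<close> (and hence on matrices) is entrywise for \<open>\<le>\<close>; the library's \<open><\<close>
  is only the strict part of \<open>\<le>\<close>, so entrywise strict positivity is written with an explicit
  quantifier over the components.  The vector \<open>1\<close> is the all-ones vector.
\<close>

definition stochastic :: "real ^ 'n \<Rightarrow> bool" where
  "stochastic a \<longleftrightarrow> a \<bullet> 1 = 1 \<and> 0 \<le> a"

definition feasible_matrices :: "real ^ 'n \<Rightarrow> real ^ 'n \<Rightarrow> (real ^ 'n ^ 'n) set" where
  "feasible_matrices p q = {U. transpose U *v q = p \<and> U *v 1 = 1 \<and> 0 \<le> U}"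

definition pos_part :: "real \<Rightarrow> real" where
  "pos_part c = max c 0"

definition Ubar :: "real ^ 'n \<Rightarrow> real ^ 'n \<Rightarrow> real ^ 'n ^ 'n" where
  "Ubar p q = (\<chi> i j.
     if i = j then 1 - pos_part (1 - p $ i / q $ i)
     else if p = q then 0
     else pos_part (1 - p $ i / q $ i) * pos_part (p $ j - q $ j)
            / (\<Sum>k\<in>UNIV. pos_part (p $ k - q $ k)))"

definition unique_maximizer :: "('a \<Rightarrow> real) \<Rightarrow> 'a set \<Rightarrow> 'a \<Rightarrow> bool" where
  "unique_maximizer f S x \<longleftrightarrow>
     is_arg_max f (\<lambda>y. y \<in> S) x \<and> (\<forall>y. is_arg_max f (\<lambda>y. y \<in> S) y \<longrightarrow> y = x)"

end

theory Submission
  imports Defs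
begin

text \<open>
  Column \<open>i\<close> and row \<open>i\<close> of a feasible \<open>U\<close> force \<open>U\<^sub>i\<^sub>i \<le> min 1 (p\<^sub>i / q\<^sub>i)\<close>, and \<open>Ubar p q\<close> is a
  feasible matrix attaining all these bounds at once.  Hence the optimal solutions are exactly the
  feasible matrices with the diagonal of \<open>Ubar p q\<close> (\<open>optimal_iff_diagonal\<close>).

  With the diagonal fixed, the numbers \<open>q\<^sub>i U\<^sub>i\<^sub>j\<close>, \<open>i \<noteq> j\<close>, form a transportation plan: row \<open>i\<close> ships
  the supply \<open>[q\<^sub>i - p\<^sub>i]\<^sup>+\<close> and column \<open>j\<close> receives the demand \<open>[p\<^sub>j - q\<^sub>j]\<^sup>+\<close>.  All mass therefore
  lives on the block \<open>L \<times> G\<close>, where \<open>L = {i. p\<^sub>i < q\<^sub>i}\<close> and \<open>G = {j. p\<^sub>j > q\<^sub>j}\<close>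
  (\<open>optimal_off_diagonal_zero\<close>).  If the block has at most one column or at most one row, the
  marginals determine the plan, so there is only one optimal solution.  Otherwise the plan of
  \<open>Ubar p q\<close>, which is the product plan and so strictly positive on the block, can be changed by
  moving a little mass around a \<open>2 \<times> 2\<close> minor; this preserves all marginals and the diagonal
  and gives a second optimal solution (\<open>second_optimal_solution\<close>).
\<close>

section \<open>Feasible matrices and the trace bound\<close>

lemma feasible_matrices_iff:
  "U \<in> feasible_matrices p q \<longleftrightarrow>
     (\<forall>j. (\<Sum>i\<in>UNIV. q $ i * U $ i $ j) = p $ j) \<and> (\<forall>i. (\<Sum>j\<in>UNIV. U $ i $ j) = 1) \<and>
     (\<forall>i j. 0 \<le> U $ i $ j)"
  by (simp add: feasible_matrices_def vec_eq_iff matrix_vector_mult_def transpose_def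
      less_eq_vec_def mult.commute)

lemma stochastic_sum: "stochastic a \<Longrightarrow> (\<Sum>i\<in>UNIV. a $ i) = 1"
  by (simp add: stochastic_def inner_vec_def)

text \<open>
  The case distinction in \<open>Ubar\<close> is immaterial: on the diagonal the product term vanishes because
  an index cannot have both excess and deficit, and for \<open>p = q\<close> there is no deficit at all.  In
  this form \<open>Ubar\<close> is a diagonal matrix plus a rank-one matrix.
\<close>

lemma Ubar_nth:
  assumes "\<forall>i. q $ i > 0"
  shows "Ubar p q $ i $ j = (if i = j then 1 - pos_part (q $ i - p $ i) / q $ i else 0)
    + pos_part (q $ i - p $ i) / q $ i * pos_part (p $ j - q $ j)
      / (\<Sum>k\<in>UNIV. pos_part (p $ k - q $ k))"
proof -
  have "pos_part (1 - p $ i / q $ i) = pos_part (q $ i - p $ i) / q $ i"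
    using assms[rule_format, of i] by (auto simp: pos_part_def max_def field_simps)
  moreover have "pos_part (q $ i - p $ i) * pos_part (p $ i - q $ i) = 0"
    by (auto simp: pos_part_def max_def)
  ultimately show ?thesis by (auto simp: Ubar_def pos_part_def)
qed

lemma Ubar_diagonal:
  assumes "\<forall>i. q $ i > 0"
  shows "Ubar p q $ i $ i = min 1 (p $ i / q $ i)"
  using assms[rule_format, of i]
  by (auto simp: Ubar_def pos_part_def min_def max_def field_simps)

lemma total_excess_eq_total_deficit:
  assumes "(\<Sum>i\<in>UNIV. p $ i) = (\<Sum>i\<in>UNIV. q $ i)"
  shows "(\<Sum>i\<in>UNIV. pos_part (q $ i - p $ i)) = (\<Sum>i\<in>UNIV. pos_part (p $ i - q $ i))"
proof -
  have "(\<Sum>i\<in>UNIV. pos_part (q $ i - p $ i)) - (\<Sum>i\<in>UNIV. pos_part (p $ i - q $ i))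
      = (\<Sum>i\<in>UNIV. q $ i - p $ i)"
    unfolding sum_subtractf[symmetric] by (rule sum.cong) (auto simp: pos_part_def max_def)
  then show ?thesis using assms by (simp add: sum_subtractf)
qed

lemma Ubar_feasible:
  assumes sums: "(\<Sum>i\<in>UNIV. p $ i) = (\<Sum>i\<in>UNIV. q $ i)"
    and p: "\<forall>i. p $ i > 0" and q: "\<forall>i. q $ i > 0"
  shows "Ubar p q \<in> feasible_matrices p q"
proof -
  define a where "a i = pos_part (p $ i - q $ i)" for i
  define b where "b i = pos_part (q $ i - p $ i)" for i
  have U: "Ubar p q $ i $ j = (if i = j then 1 - b i / q $ i else 0) + b i / q $ i * a j / sum a UNIV"
    for i j using Ubar_nth[OF q] by (simp add: a_def b_def)
  have ab: "sum b UNIV = sum a UNIV"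
    using total_excess_eq_total_deficit[OF sums] by (simp add: a_def b_def)
  have nonneg: "a i \<ge> 0" "b i \<ge> 0" for i by (auto simp: a_def b_def pos_part_def)
  have qnz: "q $ i \<noteq> 0" for i using q by (simp add: less_imp_neq[symmetric])
  \<comment> \<open>If the total vanishes then so do all its terms, and division by zero does no harm.\<close>
  have zero: "a i = 0 \<and> b i = 0" if "sum a UNIV = 0" for i
    using that ab nonneg sum_nonneg_eq_0_iff[of UNIV a] sum_nonneg_eq_0_iff[of UNIV b] by auto
  have "(\<Sum>i\<in>UNIV. q $ i * Ubar p q $ i $ j) = p $ j" for j
  proof -
    have "(\<Sum>i\<in>UNIV. q $ i * Ubar p q $ i $ j)
        = (\<Sum>i\<in>UNIV. (if i = j then q $ i - b i else 0) + b i * (a j / sum a UNIV))"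
      by (rule sum.cong) (auto simp: U qnz field_simps)
    also have "\<dots> = q $ j - b j + sum b UNIV * (a j / sum a UNIV)"
      unfolding sum.distrib sum_distrib_right by simp
    also have "\<dots> = q $ j - b j + a j" using zero[of j] by (cases "sum a UNIV = 0") (auto simp: ab)
    also have "\<dots> = p $ j" by (auto simp: a_def b_def pos_part_def max_def)
    finally show ?thesis .
  qed
  moreover have "(\<Sum>j\<in>UNIV. Ubar p q $ i $ j) = 1" for i
  proof -
    have "(\<Sum>j\<in>UNIV. Ubar p q $ i $ j) = 1 - b i / q $ i + b i / q $ i * sum a UNIV / sum a UNIV"
      by (simp add: U sum.distrib sum_distrib_left sum_divide_distrib)
    then show ?thesis using zero[of i] by (cases "sum a UNIV = 0") auto
  qed
  moreover have "0 \<le> Ubar p q $ i $ j" for i j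
  proof (cases "i = j")
    case True
    then show ?thesis using p q by (simp add: Ubar_diagonal[OF q] less_imp_le)
  next
    case False
    then show ?thesis using nonneg q by (simp add: U sum_nonneg less_imp_le)
  qed
  ultimately show ?thesis by (simp add: feasible_matrices_iff)
qed

lemma feasible_diagonal_le:
  assumes "U \<in> feasible_matrices p q" and q: "\<forall>i. q $ i > 0"
  shows "U $ i $ i \<le> min 1 (p $ i / q $ i)"
proof -
  have col: "(\<Sum>k\<in>UNIV. q $ k * U $ k $ i) = p $ i" and row: "(\<Sum>k\<in>UNIV. U $ i $ k) = 1"
    and nonneg: "0 \<le> U $ k $ j" for k j
    using assms(1) by (auto simp: feasible_matrices_iff)
  have "q $ i * U $ i $ i \<le> p $ i"
    unfolding col[symmetric] using nonneg q by (intro member_le_sum) (auto simp: less_imp_le)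
  moreover have "U $ i $ i \<le> 1"
    unfolding row[symmetric] using nonneg by (intro member_le_sum) auto
  ultimately show ?thesis using q by (simp add: field_simps)
qed

text \<open>
  Every diagonal entry of \<open>Ubar\<close> is as large as feasibility permits, so a feasible matrix reaches
  the same trace only by reaching every single bound.
\<close>

lemma optimal_iff_diagonal:
  assumes sums: "(\<Sum>i\<in>UNIV. p $ i) = (\<Sum>i\<in>UNIV. q $ i)"
    and p: "\<forall>i. p $ i > 0" and q: "\<forall>i. q $ i > 0"
  shows "is_arg_max trace (\<lambda>V. V \<in> feasible_matrices p q) U \<longleftrightarrow>
    U \<in> feasible_matrices p q \<and> (\<forall>i. U $ i $ i = min 1 (p $ i / q $ i))"
    (is "?opt \<longleftrightarrow> ?diag")
proof
  have Ubar: "Ubar p q \<in> feasible_matrices p q" by (rule Ubar_feasible[OF sums p q])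
  {
    assume ?opt
    then have U: "U \<in> feasible_matrices p q" and "trace (Ubar p q) \<le> trace U"
      using Ubar by (auto simp: is_arg_max_linorder)
    then have "(\<Sum>i\<in>UNIV. min 1 (p $ i / q $ i) - U $ i $ i) \<le> 0"
      by (simp add: trace_def Ubar_diagonal[OF q] sum_subtractf)
    moreover have gap: "0 \<le> min 1 (p $ i / q $ i) - U $ i $ i" for i
      using feasible_diagonal_le[OF U q, of i] by simp
    ultimately have "(\<Sum>i\<in>UNIV. min 1 (p $ i / q $ i) - U $ i $ i) = 0"
      by (intro antisym sum_nonneg) auto
    then have "\<forall>i. min 1 (p $ i / q $ i) - U $ i $ i = 0"
      using gap by (subst (asm) sum_nonneg_eq_0_iff) auto
    then show ?diag using U by auto
  next
    assume ?diag
    then show ?opt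
      using feasible_diagonal_le[OF _ q] by (auto simp: is_arg_max_linorder trace_def intro: sum_mono)
  }
qed

section \<open>Uniqueness when one side of the block is a single index\<close>

lemma sum_eq_single_term:
  fixes f :: "'n::finite \<Rightarrow> real"
  assumes "\<And>k. k \<noteq> i \<Longrightarrow> f k = 0"
  shows "sum f UNIV = f i"
  using assms sum.mono_neutral_right[of UNIV "{i}" f] by simp

lemma nonneg_sum_eq_term_imp_zero:
  fixes f :: "'n::finite \<Rightarrow> real"
  assumes "\<And>k. 0 \<le> f k" and "sum f UNIV = f i" and "j \<noteq> i"
  shows "f j = 0"
proof -
  have "sum f (UNIV - {i}) = 0" using assms(2) sum.remove[of UNIV i f] by simp
  then show ?thesis using assms(1,3) by (subst (asm) sum_nonneg_eq_0_iff) auto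
qed

text \<open>
  A diagonal entry equal to \<open>1\<close> uses up its row, which happens outside \<open>L\<close>; a diagonal entry
  equal to \<open>p\<^sub>j / q\<^sub>j\<close> uses up its column, which happens outside \<open>G\<close>.
\<close>

lemma optimal_off_diagonal_zero:
  assumes U: "U \<in> feasible_matrices p q" and q: "\<forall>i. q $ i > 0"
    and diag: "\<forall>i. U $ i $ i = min 1 (p $ i / q $ i)"
    and "i \<noteq> j" and outside: "q $ i \<le> p $ i \<or> p $ j \<le> q $ j"
  shows "U $ i $ j = 0"
  using outside
proof
  assume "q $ i \<le> p $ i"
  then have "U $ i $ i = 1" using q diag by (simp add: min_def)
  then show ?thesis
    using U \<open>i \<noteq> j\<close> nonneg_sum_eq_term_imp_zero[of "\<lambda>k. U $ i $ k" i j]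
    by (simp add: feasible_matrices_iff)
next
  assume "p $ j \<le> q $ j"
  then have "U $ j $ j = p $ j / q $ j"
    using q[rule_format, of j] diag by (auto simp: min_def field_simps)
  then have "q $ j * U $ j $ j = p $ j" using q[rule_format, of j] by simp
  then have "q $ i * U $ i $ j = 0"
    using U q \<open>i \<noteq> j\<close> nonneg_sum_eq_term_imp_zero[of "\<lambda>k. q $ k * U $ k $ j" j i]
    by (simp add: feasible_matrices_iff less_imp_le)
  then show ?thesis using q[rule_format, of i] by simp
qed

text \<open>
  The difference of two optimal solutions has vanishing row sums and vanishing \<open>q\<close>-weighted column
  sums, and is supported on \<open>L \<times> G\<close>.  If \<open>G\<close> (or \<open>L\<close>) has at most one element, each row (or column)
  sum has at most one nonzero term, which must then vanish too.
\<close>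

lemma optimal_unique:
  assumes U: "U \<in> feasible_matrices p q" "\<forall>i. U $ i $ i = min 1 (p $ i / q $ i)"
    and V: "V \<in> feasible_matrices p q" "\<forall>i. V $ i $ i = min 1 (p $ i / q $ i)"
    and q: "\<forall>i. q $ i > 0"
    and small: "card {i. p $ i > q $ i} \<le> 1 \<or> card {i. p $ i < q $ i} \<le> 1"
  shows "U = V"
proof -
  define D where "D i j = U $ i $ j - V $ i $ j" for i j
  have supp: "D i j = 0" if "q $ i \<le> p $ i \<or> p $ j \<le> q $ j" for i j
  proof (cases "i = j")
    case True
    then show ?thesis by (simp add: D_def U(2) V(2))
  next
    case False
    then show ?thesis
      using that optimal_off_diagonal_zero[OF U(1) q U(2)] optimal_off_diagonal_zero[OF V(1) q V(2)]
      by (auto simp: D_def)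
  qed
  have row: "(\<Sum>j\<in>UNIV. D i j) = 0" for i
    using U(1) V(1) by (simp add: D_def sum_subtractf feasible_matrices_iff)
  have col: "(\<Sum>i\<in>UNIV. q $ i * D i j) = 0" for j
    using U(1) V(1) by (simp add: D_def sum_subtractf right_diff_distrib feasible_matrices_iff)
  have "D i j = 0" for i j
  proof (cases "q $ i \<le> p $ i \<or> p $ j \<le> q $ j")
    case True
    then show ?thesis by (rule supp)
  next
    case False
    from small show ?thesis
    proof
      assume "card {i. p $ i > q $ i} \<le> 1"
      then have "k = j" if "p $ k > q $ k" for k
        using that False by (simp add: card_le_Suc0_iff_eq not_le)
      then have "p $ k \<le> q $ k" if "k \<noteq> j" for k using that not_le by blast
      then show ?thesis using row[of i] sum_eq_single_term[of j "D i"] supp by simp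
    next
      assume "card {i. p $ i < q $ i} \<le> 1"
      then have "k = i" if "p $ k < q $ k" for k
        using that False by (simp add: card_le_Suc0_iff_eq not_le)
      then have "q $ k \<le> p $ k" if "k \<noteq> i" for k using that not_le by blast
      then have "q $ i * D i j = 0"
        using col[of j] sum_eq_single_term[of i "\<lambda>k. q $ k * D k j"] supp by simp
      then show ?thesis using q[rule_format, of i] by simp
    qed
  qed
  then show ?thesis by (simp add: D_def vec_eq_iff)
qed

section \<open>A second optimal solution otherwise\<close>

lemma Ubar_pos_on_block:
  assumes "\<forall>i. q $ i > 0" and "p $ i < q $ i" and "p $ j > q $ j"
  shows "Ubar p q $ i $ j > 0"
proof -
  have "0 < pos_part (p $ j - q $ j)" using assms(3) by (simp add: pos_part_def)
  also have "\<dots> \<le> (\<Sum>k\<in>UNIV. pos_part (p $ k - q $ k))"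
    by (rule member_le_sum) (auto simp: pos_part_def)
  finally show ?thesis using assms by (auto simp: Ubar_nth pos_part_def)
qed

text \<open>
  The perturbation is the rank-one matrix \<open>x\<^sub>i y\<^sub>j\<close> with \<open>\<Sum>\<^sub>i q\<^sub>i x\<^sub>i = 0\<close> and \<open>\<Sum>\<^sub>j y\<^sub>j = 0\<close>, where
  \<open>x\<close> lives on two elements \<open>l, l'\<close> of \<open>L\<close> and \<open>y\<close> on two elements \<open>g, g'\<close> of \<open>G\<close>.  The two sum
  conditions preserve the constraints, and disjointness of \<open>L\<close> and \<open>G\<close> preserves the diagonal.
\<close>

lemma second_optimal_solution:
  assumes U: "U \<in> feasible_matrices p q" and q: "\<forall>i. q $ i > 0"
    and l: "p $ l < q $ l" "p $ l' < q $ l'" "l \<noteq> l'"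
    and g: "p $ g > q $ g" "p $ g' > q $ g'" "g \<noteq> g'"
    and pos: "U $ l $ g' > 0" "U $ l' $ g > 0"
  obtains V where "V \<in> feasible_matrices p q" "\<forall>i. V $ i $ i = U $ i $ i" "V \<noteq> U"
proof -
  define x where "x i = (if i = l then 1 / q $ l else 0) - (if i = l' then 1 / q $ l' else 0)" for i
  define y :: "'a \<Rightarrow> real" where
    "y j = (if j = g then 1 else 0) - (if j = g' then 1 else 0)" for j
  \<comment> \<open>The largest amount that can be taken from the two decreasing positions \<open>(l, g')\<close>, \<open>(l', g)\<close>.\<close>
  define e where "e = min (q $ l * U $ l $ g') (q $ l' * U $ l' $ g)"
  define V :: "real^'a^'a" where "V = (\<chi> i j. U $ i $ j + e * x i * y j)"
  have ql: "q $ l > 0" "q $ l' > 0" using q by auto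
  have e: "e > 0" using pos ql by (simp add: e_def)
  have "e \<le> q $ l * U $ l $ g'" "e \<le> q $ l' * U $ l' $ g" by (auto simp: e_def)
  then have e_le: "e / q $ l \<le> U $ l $ g'" "e / q $ l' \<le> U $ l' $ g"
    using ql by (auto simp: field_simps)
  have sum_y: "sum y UNIV = 0" by (simp add: y_def sum_subtractf)
  have sum_x: "(\<Sum>i\<in>UNIV. q $ i * x i) = 0"
  proof -
    have "(\<Sum>i\<in>UNIV. q $ i * x i) = (\<Sum>i\<in>UNIV. (if i = l then 1 else 0) - (if i = l' then 1 else 0))"
      using ql by (intro sum.cong) (auto simp: x_def)
    then show ?thesis by (simp add: sum_subtractf)
  qed
  have "(\<Sum>i\<in>UNIV. q $ i * V $ i $ j) = p $ j" for j
  proof -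
    have "(\<Sum>i\<in>UNIV. q $ i * V $ i $ j)
        = (\<Sum>i\<in>UNIV. q $ i * U $ i $ j) + (\<Sum>i\<in>UNIV. q $ i * x i) * (e * y j)"
      by (simp add: V_def sum.distrib distrib_left sum_distrib_left mult_ac)
    then show ?thesis using U by (simp add: sum_x feasible_matrices_iff)
  qed
  moreover have "(\<Sum>j\<in>UNIV. V $ i $ j) = 1" for i
    using U sum_y by (simp add: V_def sum.distrib sum_distrib_left[symmetric] feasible_matrices_iff)
  moreover have "0 \<le> V $ i $ j" for i j
  proof -
    have "0 \<le> U $ i $ j" using U by (simp add: feasible_matrices_iff)
    moreover have "0 \<le> e / q $ l" "0 \<le> e / q $ l'" using e ql by simp_all
    ultimately show ?thesis using e_le l(3) g(3) by (auto simp: V_def x_def y_def)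
  qed
  ultimately have "V \<in> feasible_matrices p q" by (simp add: feasible_matrices_iff)
  moreover have "\<forall>i. V $ i $ i = U $ i $ i"
    using l g by (auto simp: V_def x_def y_def)
  moreover have "V \<noteq> U"
  proof
    assume "V = U"
    then have "V $ l $ g = U $ l $ g" by simp
    then show False using e ql l g by (simp add: V_def x_def y_def)
  qed
  ultimately show thesis by (rule that)
qed

lemma two_elements:
  assumes "\<not> card (A :: 'n::finite set) \<le> 1"
  obtains a b where "a \<in> A" "b \<in> A" "a \<noteq> b"
  using assms by (auto simp: card_le_Suc0_iff_eq)

section \<open>The characterization\<close>

theorem theorem7:
  fixes p q :: "real ^ 'n"
  assumes "stochastic p" and "stochastic q"
    and "\<forall>i. p $ i > 0" and "\<forall>i. q $ i > 0"
  shows "unique_maximizer trace (feasible_matrices p q) (Ubar p q) \<longleftrightarrow>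
         card {i. p $ i > q $ i} \<le> 1 \<or> card {i. p $ i < q $ i} \<le> 1"
proof
  note q = assms(4)
  have sums: "(\<Sum>i\<in>UNIV. p $ i) = (\<Sum>i\<in>UNIV. q $ i)"
    using assms(1,2) by (simp add: stochastic_sum)
  note opt = optimal_iff_diagonal[OF sums assms(3,4)]
  have Ubar: "Ubar p q \<in> feasible_matrices p q" "\<forall>i. Ubar p q $ i $ i = min 1 (p $ i / q $ i)"
    using Ubar_feasible[OF sums assms(3,4)] Ubar_diagonal[OF q] by auto
  {
    assume "card {i. p $ i > q $ i} \<le> 1 \<or> card {i. p $ i < q $ i} \<le> 1"
    then have "U = Ubar p q"
      if "U \<in> feasible_matrices p q" "\<forall>i. U $ i $ i = min 1 (p $ i / q $ i)" for U
      using optimal_unique[OF that Ubar q] by blast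
    then show "unique_maximizer trace (feasible_matrices p q) (Ubar p q)"
      using Ubar unfolding unique_maximizer_def opt by blast
  next
    assume unique: "unique_maximizer trace (feasible_matrices p q) (Ubar p q)"
    show "card {i. p $ i > q $ i} \<le> 1 \<or> card {i. p $ i < q $ i} \<le> 1"
    proof (rule ccontr)
      assume "\<not> ?thesis"
      then have cards: "\<not> card {i. p $ i > q $ i} \<le> 1" "\<not> card {i. p $ i < q $ i} \<le> 1" by auto
      obtain g g' where g: "p $ g > q $ g" "p $ g' > q $ g'" "g \<noteq> g'"
        by (rule two_elements[OF cards(1)]) simp
      obtain l l' where l: "p $ l < q $ l" "p $ l' < q $ l'" "l \<noteq> l'"
        by (rule two_elements[OF cards(2)]) simp
      obtain V where "V \<in> feasible_matrices p q" "\<forall>i. V $ i $ i = Ubar p q $ i $ i" "V \<noteq> Ubar p q"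
        using second_optimal_solution[OF Ubar(1) q l g Ubar_pos_on_block[OF q l(1) g(2)]
            Ubar_pos_on_block[OF q l(2) g(1)]] .
      moreover from this have "\<forall>i. V $ i $ i = min 1 (p $ i / q $ i)" using Ubar(2) by simp
      ultimately show False using unique unfolding unique_maximizer_def opt by blast
    qed
  }
qed

end
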